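(* Let $m\ge 1$. For $\mathbf p=(p_1,\dots,p_{2m})\in\mathbb N_0^{2m}$, $P=\sum_{i=1}^{2m}p_i$ and $r\in\mathbb Z$, let $$g[\mathbf p;r]=\frac{(\mu^{1})^{p_1}(\mu^{2})^{p_2}\cdots(\mu^{2m})^{p_{2m}}}{\lambda_0^{P-2-r}\,\lambda_1^{r}} .$$ Then for all $\mathbf p,\mathbf q\in\mathbb N_0^{2m}$ and $r,s\in\mathbb Z$, $$\{g[\mathbf p;r],g[\mathbf q;s]\}=\sum_{i=1}^{m}\left(p_i\,q_{i+m}-p_{i+m}\,q_i\right)g[\mathbf p+\mathbf q-\mathbf 1_i-\mathbf 1_{i+m};\,r+s],$$ so the span of the modes $g[\mathbf p;r]$ is closed under the Poisson bracket. With this bracket, the Lie algebra spanned by the modes is isomorphic to the loop algebra $\mathcal L\mathfrak{ham}(\mathbb C^{2m})$.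
   Context: The variables are $\mu^{1},\dots,\mu^{2m}$ and $\lambda_0,\lambda_1$ (homogeneous coordinates on the twistor space $\{[\mu:\lambda]\in\mathbb{P}^{2m+1}:\lambda\ne0\}$, restricted to $\lambda_0\lambda_1\neq0$). The modes are homogeneous of degree $2$ in $(\mu,\lambda)$. They are the modes of infinitesimal deformations of the twistor space of flat $\mathbb C^{4m}$ which preserve the fibration over $\mathbb P^1$ and the Poisson structure on the fibres. The (weighted) Poisson bracket is $\{f,g\}=\sum_{i=1}^m\left(\frac{\partial f}{\partial\mu^i}\frac{\partial g}{\partial\mu^{i+m}}-\frac{\partial f}{\partial\mu^{i+m}}\frac{\partial g}{\partial\mu^{i}}\right)$, with $\lambda_0,\lambda_1$ treated as constants. $\mathbf 1_i\in\mathbb N_0^{2m}$ is the vector with $(\mathbf 1_i)_j=\delta_{ij}$. Terms whose numerical coefficient vanishes are understood to be zero (so $g$ with a negative exponent never appears). $\mathfrak{ham}(\mathbb C^{2m})$ denotes the Lie algebra of polynomial Hamiltonian functions on $\mathbb C^{2m}$ under the standard Poisson bracket. It has basis $w[\mathbf p]=(\mu^1)^{p_1}\cdots(\mu^{2m})^{p_{2m}}$, $\mathbf p\in\mathbb N_0^{2m}$, and bracket $\{w[\mathbf p],w[\mathbf q]\}=\sum_{i=1}^m(p_iq_{i+m}-p_{i+m}q_i)\,w[\mathbf p+\mathbf q-\mathbf 1_i-\mathbf 1_{i+m}]$. Its (complexified) loop algebra is $\mathcal L\mathfrak{ham}(\mathbb C^{2m})=\mathfrak{ham}(\mathbb C^{2m})\otimes\mathbb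 C[\lambda,\lambda^{-1}]$ with bracket $[a\otimes\lambda^{k},b\otimes\lambda^{l}]=\{a,b\}\otimes\lambda^{k+l}$. *)

theory Defs
  imports
    "HOL-Analysis.Analysis"
    "HOL-Library.Function_Algebras"
    "HOL-Library.Poly_Mapping"
begin

definition linear_map_on ::
  "('k \<Rightarrow> 'a::ab_group_add \<Rightarrow> 'a) \<Rightarrow> ('k \<Rightarrow> 'b::ab_group_add \<Rightarrow> 'b) \<Rightarrow> 'a set \<Rightarrow> ('a \<Rightarrow> 'b) \<Rightarrow> bool"
  where "linear_map_on s t V f \<longleftrightarrow>
    (\<forall>x\<in>V. \<forall>y\<in>V. f (x + y) = f x + f y) \<and> (\<forall>c. \<forall>x\<in>V. f (s c x) = t c (f x))"

locale lie_algebra = vector_space scale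
  for scale :: "'k::field \<Rightarrow> 'a::ab_group_add \<Rightarrow> 'a" +
  fixes L :: "'a set" and br :: "'a \<Rightarrow> 'a \<Rightarrow> 'a"
  assumes subspace_carrier: "module.subspace scale L"
    and closed: "x \<in> L \<Longrightarrow> y \<in> L \<Longrightarrow> br x y \<in> L"
    and linear_left: "y \<in> L \<Longrightarrow> linear_map_on scale scale L (\<lambda>x. br x y)"
    and linear_right: "x \<in> L \<Longrightarrow> linear_map_on scale scale L (br x)"
    and alternating: "x \<in> L \<Longrightarrow> br x x = 0"
    and jacobi: "x \<in> L \<Longrightarrow> y \<in> L \<Longrightarrow> z \<in> L \<Longrightarrow>
      br x (br y z) + br y (br z x) + br z (br x y) = 0"

definition lie_isomorphism ::
  "('k \<Rightarrow> 'a::ab_group_add \<Rightarrow> 'a) \<Rightarrow> 'a set \<Rightarrow> ('a \<Rightarrow> 'a \<Rightarrow> 'a) \<Rightarrow>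
   ('k \<Rightarrow> 'b::ab_group_add \<Rightarrow> 'b) \<Rightarrow> 'b set \<Rightarrow> ('b \<Rightarrow> 'b \<Rightarrow> 'b) \<Rightarrow> ('a \<Rightarrow> 'b) \<Rightarrow> bool"
  where "lie_isomorphism s L br t M br' \<phi> \<longleftrightarrow>
    bij_betw \<phi> L M \<and> linear_map_on s t L \<phi> \<and>
    (\<forall>x\<in>L. \<forall>y\<in>L. \<phi> (br x y) = br' (\<phi> x) (\<phi> y))"

definition lie_isomorphic ::
  "('k::field \<Rightarrow> 'a::ab_group_add \<Rightarrow> 'a) \<Rightarrow> 'a set \<Rightarrow> ('a \<Rightarrow> 'a \<Rightarrow> 'a) \<Rightarrow>
   ('k \<Rightarrow> 'b::ab_group_add \<Rightarrow> 'b) \<Rightarrow> 'b set \<Rightarrow> ('b \<Rightarrow> 'b \<Rightarrow> 'b) \<Rightarrow> bool"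
  where "lie_isomorphic s L br t M br' \<longleftrightarrow>
    lie_algebra s L br \<and> lie_algebra t M br' \<and> (\<exists>\<phi>. lie_isomorphism s L br t M br' \<phi>)"


text \<open>
  The tensor product of a vector space \<open>V\<close> with the Laurent polynomials \<open>\<complex>[\<lambda>,\<lambda>\<inverse>]\<close>, the latter being
  the type \<open>int \<Rightarrow>\<^sub>0 complex\<close>, is realised as the space of Laurent polynomials with coefficients in
  \<open>V\<close>: the finitely supported \<open>x\<close> stands for the sum of all \<open>x\<^sub>k \<otimes> \<lambda>\<^sup>k\<close>. Lemmas \<open>loop_tensor_universal\<close>
  and \<open>loop_tensor_unique\<close> below establish the universal property of the tensor product, and
  \<open>loop_bracket_tensor\<close> the defining formula of the loop bracket.
\<close>

definition loop_space :: "'a::zero set \<Rightarrow> (int \<Rightarrow>\<^sub>0 'a) set"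
  where "loop_space V = {x. \<forall>k. Poly_Mapping.lookup x k \<in> V}"

definition loop_scale :: "('k \<Rightarrow> 'a::zero \<Rightarrow> 'a) \<Rightarrow> 'k \<Rightarrow> (int \<Rightarrow>\<^sub>0 'a) \<Rightarrow> (int \<Rightarrow>\<^sub>0 'a)"
  where "loop_scale s c x = Poly_Mapping.map (s c) x"

definition loop_bracket ::
  "('a::comm_monoid_add \<Rightarrow> 'a \<Rightarrow> 'a) \<Rightarrow> (int \<Rightarrow>\<^sub>0 'a) \<Rightarrow> (int \<Rightarrow>\<^sub>0 'a) \<Rightarrow> (int \<Rightarrow>\<^sub>0 'a)"
  where "loop_bracket br x y =
    (\<Sum>k\<in>Poly_Mapping.keys x. \<Sum>l\<in>Poly_Mapping.keys y.
       Poly_Mapping.single (k + l) (br (Poly_Mapping.lookup x k) (Poly_Mapping.lookup y l)))"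

definition loop_tensor ::
  "('k::zero \<Rightarrow> 'a::zero \<Rightarrow> 'a) \<Rightarrow> 'a \<Rightarrow> (int \<Rightarrow>\<^sub>0 'k) \<Rightarrow> (int \<Rightarrow>\<^sub>0 'a)"
  where "loop_tensor s a h = Poly_Mapping.map (\<lambda>c. s c a) h"

lemma lookup_loop_scale:
  assumes "vector_space s"
  shows "Poly_Mapping.lookup (loop_scale s c x) k = s c (Poly_Mapping.lookup x k)"
proof -
  interpret vector_space s by fact
  show ?thesis by (simp add: loop_scale_def Poly_Mapping.map.rep_eq when_def)
qed

lemma lookup_loop_tensor:
  assumes "vector_space s"
  shows "Poly_Mapping.lookup (loop_tensor s a h) k = s (Poly_Mapping.lookup h k) a"
proof -
  interpret vector_space s by fact
  show ?thesis by (simp add: loop_tensor_def Poly_Mapping.map.rep_eq when_def)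
qed

lemma vector_space_loop_scale:
  assumes "vector_space s"
  shows "vector_space (loop_scale s)"
proof -
  interpret vector_space s by fact
  show ?thesis
    by unfold_locales
      (auto intro!: poly_mapping_eqI
        simp: lookup_loop_scale[OF assms] lookup_add scale_right_distrib scale_left_distrib)
qed

lemma loop_tensor_single:
  assumes "vector_space s"
  shows "loop_tensor s a (Poly_Mapping.single k 1) = Poly_Mapping.single k a"
proof -
  interpret vector_space s by fact
  show ?thesis
    by (rule poly_mapping_eqI) (simp add: lookup_loop_tensor[OF assms] lookup_single when_def)
qed

lemma loop_bracket_tensor:
  assumes "vector_space s" and "br 0 b = 0" and "br a 0 = 0"
  shows "loop_bracket br (loop_tensor s a (Poly_Mapping.single k 1))
           (loop_tensor s b (Poly_Mapping.single l 1)) =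
         loop_tensor s (br a b) (Poly_Mapping.single (k + l) 1)"
  using assms by (auto simp: loop_bracket_def loop_tensor_single)

lemma loop_space_decompose: "(\<Sum>k\<in>Poly_Mapping.keys x. Poly_Mapping.single k (Poly_Mapping.lookup x k)) = x"
proof (rule poly_mapping_eqI)
  fix j
  show "Poly_Mapping.lookup (\<Sum>k\<in>Poly_Mapping.keys x. Poly_Mapping.single k (Poly_Mapping.lookup x k)) j
        = Poly_Mapping.lookup x j"
    by (auto simp: lookup_sum lookup_single when_def in_keys_iff)
qed

lemma loop_tensor_bilinear:
  assumes "vector_space s" and "module.subspace s V"
  shows "a \<in> V \<Longrightarrow> loop_tensor s a h \<in> loop_space V"
    and "linear_map_on s (loop_scale s) V (\<lambda>a. loop_tensor s a h)"
    and "linear_map_on (loop_scale (*)) (loop_scale s) UNIV (loop_tensor s a)"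
proof -
  interpret vector_space s by fact
  have mult: "vector_space ((*) :: 'a \<Rightarrow> 'a \<Rightarrow> 'a)"
    by unfold_locales (auto simp: algebra_simps)
  show "a \<in> V \<Longrightarrow> loop_tensor s a h \<in> loop_space V"
    using assms(2) by (simp add: loop_space_def lookup_loop_tensor[OF assms(1)] subspace_scale)
  show "linear_map_on s (loop_scale s) V (\<lambda>a. loop_tensor s a h)"
    by (auto intro!: poly_mapping_eqI
        simp: linear_map_on_def lookup_loop_tensor[OF assms(1)] lookup_loop_scale[OF assms(1)]
          lookup_add scale_right_distrib mult.commute)
  show "linear_map_on (loop_scale (*)) (loop_scale s) UNIV (loop_tensor s a)"
    by (auto intro!: poly_mapping_eqI
        simp: linear_map_on_def lookup_loop_tensor[OF assms(1)] lookup_loop_scale[OF assms(1)]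
          lookup_loop_scale[OF mult] lookup_add scale_left_distrib)
qed

lemma loop_tensor_universal:
  fixes B :: "'a::ab_group_add \<Rightarrow> (int \<Rightarrow>\<^sub>0 'k::field) \<Rightarrow> 'b::ab_group_add"
  assumes s: "vector_space s" and t: "vector_space t" and V: "module.subspace s V"
    and B1: "\<And>h. linear_map_on s t V (\<lambda>a. B a h)"
    and B2: "\<And>a. a \<in> V \<Longrightarrow> linear_map_on (loop_scale (*)) t UNIV (B a)"
  shows "\<exists>F. linear_map_on (loop_scale s) t (loop_space V) F \<and>
             (\<forall>a\<in>V. \<forall>h. F (loop_tensor s a h) = B a h)"
proof -
  interpret s: vector_space s by fact
  interpret t: vector_space t by fact
  have mult: "vector_space ((*) :: 'k \<Rightarrow> 'k \<Rightarrow> 'k)"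
    by unfold_locales (auto simp: algebra_simps)
  have V0: "0 \<in> V" using V by (rule s.subspace_0)
  define F where "F x = (\<Sum>k\<in>Poly_Mapping.keys x.
     B (Poly_Mapping.lookup x k) (Poly_Mapping.single k 1))" for x
  have B0: "B 0 h = 0" for h
  proof -
    have "B (0 + 0) h = B 0 h + B 0 h"
      using B1[of h] V0 unfolding linear_map_on_def by blast
    then show ?thesis by simp
  qed
  have F_sup: "F x = (\<Sum>k\<in>S. B (Poly_Mapping.lookup x k) (Poly_Mapping.single k 1))"
    if "finite S" "Poly_Mapping.keys x \<subseteq> S" for S x
    unfolding F_def using that by (intro sum.mono_neutral_left) (auto simp: B0 in_keys_iff)
  have add: "F (x + y) = F x + F y" if x: "x \<in> loop_space V" and y: "y \<in> loop_space V" for x y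
  proof -
    let ?S = "Poly_Mapping.keys x \<union> Poly_Mapping.keys y"
    have "F (x + y) = (\<Sum>k\<in>?S. B (Poly_Mapping.lookup (x + y) k) (Poly_Mapping.single k 1))"
      by (rule F_sup) (auto simp: keys_add)
    also have "\<dots> = (\<Sum>k\<in>?S. B (Poly_Mapping.lookup x k) (Poly_Mapping.single k 1)
                     + B (Poly_Mapping.lookup y k) (Poly_Mapping.single k 1))"
      using x y B1 by (intro sum.cong) (auto simp: lookup_add linear_map_on_def loop_space_def)
    also have "\<dots> = F x + F y"
      by (simp add: sum.distrib F_sup[of ?S x] F_sup[of ?S y])
    finally show ?thesis .
  qed
  have scl: "F (loop_scale s c x) = t c (F x)" if x: "x \<in> loop_space V" for c x
  proof -
    have "F (loop_scale s c x) =
      (\<Sum>k\<in>Poly_Mapping.keys x. B (Poly_Mapping.lookup (loop_scale s c x) k) (Poly_Mapping.single k 1))"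
      by (rule F_sup) (auto simp: in_keys_iff lookup_loop_scale[OF s])
    also have "\<dots> = (\<Sum>k\<in>Poly_Mapping.keys x. t c (B (Poly_Mapping.lookup x k) (Poly_Mapping.single k 1)))"
      using x B1 by (intro sum.cong) (auto simp: lookup_loop_scale[OF s] linear_map_on_def loop_space_def)
    also have "\<dots> = t c (F x)" by (simp add: F_def t.scale_sum_right)
    finally show ?thesis .
  qed
  have ten: "F (loop_tensor s a h) = B a h" if a: "a \<in> V" for a h
  proof -
    have Ba_add: "B a (u + v) = B a u + B a v" for u v
      using B2[OF a] by (simp add: linear_map_on_def)
    have Ba_scale: "B a (loop_scale (*) c u) = t c (B a u)" for c u
      using B2[OF a] by (simp add: linear_map_on_def)
    have Ba0: "B a 0 = 0" using Ba_add[of 0 0] by simp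
    have Ba_sum: "B a (sum f A) = (\<Sum>i\<in>A. B a (f i))" if "finite A" for f and A :: "int set"
      using that by induction (auto simp: Ba0 Ba_add)
    have sgl: "Poly_Mapping.single k c = loop_scale (*) c (Poly_Mapping.single k (1::'k))" for k c
      by (rule poly_mapping_eqI) (simp add: lookup_loop_scale[OF mult] lookup_single when_def)
    have "F (loop_tensor s a h) = (\<Sum>k\<in>Poly_Mapping.keys h.
        B (Poly_Mapping.lookup (loop_tensor s a h) k) (Poly_Mapping.single k 1))"
      by (rule F_sup) (auto simp: in_keys_iff lookup_loop_tensor[OF s])
    also have "\<dots> = (\<Sum>k\<in>Poly_Mapping.keys h. t (Poly_Mapping.lookup h k) (B a (Poly_Mapping.single k 1)))"
      using B1 a by (intro sum.cong) (auto simp: lookup_loop_tensor[OF s] linear_map_on_def)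
    also have "\<dots> = (\<Sum>k\<in>Poly_Mapping.keys h. B a (Poly_Mapping.single k (Poly_Mapping.lookup h k)))"
      by (intro sum.cong refl) (metis Ba_scale sgl)
    also have "\<dots> = B a (\<Sum>k\<in>Poly_Mapping.keys h. Poly_Mapping.single k (Poly_Mapping.lookup h k))"
      by (simp add: Ba_sum)
    finally show ?thesis by (simp add: loop_space_decompose)
  qed
  show ?thesis using add scl ten unfolding linear_map_on_def by blast
qed

lemma loop_tensor_unique:
  assumes s: "vector_space s" and V: "module.subspace s V"
    and F: "linear_map_on (loop_scale s) t (loop_space V) F"
    and G: "linear_map_on (loop_scale s) t (loop_space V) G"
    and eq: "\<And>a h. a \<in> V \<Longrightarrow> F (loop_tensor s a h) = G (loop_tensor s a h)"
    and x: "x \<in> loop_space V"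
  shows "F x = G x"
proof -
  interpret s: vector_space s by fact
  have V0: "0 \<in> V" using V by (rule s.subspace_0)
  have z: "0 \<in> loop_space V" using V0 by (simp add: loop_space_def)
  have "H 0 = 0" if "linear_map_on (loop_scale s) t (loop_space V) H" for H
  proof -
    have "H (0 + 0) = H 0 + H 0" using that z unfolding linear_map_on_def by blast
    then show ?thesis by simp
  qed
  then have FG0: "F 0 = 0" "G 0 = 0" using F G by auto
  have sg: "Poly_Mapping.single k (Poly_Mapping.lookup x k) \<in> loop_space V" for k
    using x V0 by (auto simp: loop_space_def lookup_single when_def)
  have "(\<Sum>k\<in>A. Poly_Mapping.single k (Poly_Mapping.lookup x k)) \<in> loop_space V \<and>
        F (\<Sum>k\<in>A. Poly_Mapping.single k (Poly_Mapping.lookup x k)) =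
        G (\<Sum>k\<in>A. Poly_Mapping.single k (Poly_Mapping.lookup x k))" if "finite A" for A
    using that
  proof induction
    case empty
    then show ?case by (simp add: z FG0)
  next
    case (insert k A)
    have add: "u + v \<in> loop_space V" if "u \<in> loop_space V" "v \<in> loop_space V" for u v
      using that V by (simp add: loop_space_def lookup_add s.subspace_add)
    have "F (Poly_Mapping.single k (Poly_Mapping.lookup x k)) =
          G (Poly_Mapping.single k (Poly_Mapping.lookup x k))"
      using eq[of "Poly_Mapping.lookup x k" "Poly_Mapping.single k 1"] x
      by (simp add: loop_tensor_single[OF s] loop_space_def)
    then show ?case
      using insert sg[of k] F G add by (simp add: linear_map_on_def)
  qed
  from this[of "Poly_Mapping.keys x"] show ?thesis by (simp add: loop_space_decompose)
qed


text \<open>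
  Coordinates and exponents are functions on \<open>nat\<close> of which only the entries \<open>1, \<dots>, 2m\<close> are used:
  exponents vanish at all other indices, and the functions considered do not depend on the other
  coordinates. Complex functions are added pointwise.
\<close>

definition fun_scale :: "complex \<Rightarrow> ('a \<Rightarrow> complex) \<Rightarrow> ('a \<Rightarrow> complex)"
  where "fun_scale c f = (\<lambda>x. c * f x)"

lemma vector_space_fun_scale: "vector_space fun_scale"
  by unfold_locales (auto simp: fun_scale_def fun_eq_iff algebra_simps)

definition multi_indices :: "nat \<Rightarrow> (nat \<Rightarrow> nat) set"
  where "multi_indices m = {p. \<forall>i. i \<notin> {1..2*m} \<longrightarrow> p i = 0}"

text \<open>
  The truncated subtraction on \<open>nat\<close> is harmless in the exponent \<open>p + q - unit_index i - unit_index (i + m)\<close>: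
  it truncates only when \<open>p\<^sub>i q\<^sub>i\<^sub>+\<^sub>m\<close> and \<open>p\<^sub>i\<^sub>+\<^sub>m q\<^sub>i\<close> both vanish, and then the mode has coefficient zero in the
  bracket of \<open>g[p;r]\<close> and \<open>g[q;s]\<close>.
\<close>

definition unit_index :: "nat \<Rightarrow> nat \<Rightarrow> nat"
  where "unit_index i = (\<lambda>j. if j = i then 1 else 0)"

definition partial_deriv :: "nat \<Rightarrow> ((nat \<Rightarrow> complex) \<Rightarrow> complex) \<Rightarrow> (nat \<Rightarrow> complex) \<Rightarrow> complex"
  where "partial_deriv i f \<mu> = deriv (\<lambda>z. f (\<mu>(i := z))) (\<mu> i)"

definition poisson_bracket ::
  "nat \<Rightarrow> ((nat \<Rightarrow> complex) \<Rightarrow> complex) \<Rightarrow> ((nat \<Rightarrow> complex) \<Rightarrow> complex) \<Rightarrow> ((nat \<Rightarrow> complex) \<Rightarrow> complex)"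
  where "poisson_bracket m f h = (\<lambda>\<mu>. \<Sum>i=1..m.
    partial_deriv i f \<mu> * partial_deriv (i + m) h \<mu> - partial_deriv (i + m) f \<mu> * partial_deriv i h \<mu>)"

definition w_mode :: "nat \<Rightarrow> (nat \<Rightarrow> nat) \<Rightarrow> (nat \<Rightarrow> complex) \<Rightarrow> complex"
  where "w_mode m p = (\<lambda>\<mu>. \<Prod>i=1..2*m. \<mu> i ^ p i)"

definition ham :: "nat \<Rightarrow> ((nat \<Rightarrow> complex) \<Rightarrow> complex) set"
  where "ham m = module.span fun_scale {w_mode m p | p. p \<in> multi_indices m}"

text \<open>
  Functions on the region \<open>\<lambda>\<^sub>0 \<lambda>\<^sub>1 \<noteq> 0\<close>, with argument \<open>(\<mu>, \<lambda>\<^sub>0, \<lambda>\<^sub>1)\<close>, are extended by zero to the whole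
  type, so that equality of such functions is equality on the region.
\<close>

type_synonym twistor_fun = "(nat \<Rightarrow> complex) \<times> complex \<times> complex \<Rightarrow> complex"

definition g_mode :: "nat \<Rightarrow> (nat \<Rightarrow> nat) \<Rightarrow> int \<Rightarrow> twistor_fun"
  where "g_mode m p r = (\<lambda>(\<mu>, l0, l1).
    if l0 \<noteq> 0 \<and> l1 \<noteq> 0
    then (\<Prod>i=1..2*m. \<mu> i ^ p i) / (l0 powi (int (\<Sum>i=1..2*m. p i) - 2 - r) * l1 powi r)
    else 0)"

definition twistor_bracket :: "nat \<Rightarrow> twistor_fun \<Rightarrow> twistor_fun \<Rightarrow> twistor_fun"
  where "twistor_bracket m f h = (\<lambda>(\<mu>, l0, l1).
    poisson_bracket m (\<lambda>\<nu>. f (\<nu>, l0, l1)) (\<lambda>\<nu>. h (\<nu>, l0, l1)) \<mu>)"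

definition mode_span :: "nat \<Rightarrow> twistor_fun set"
  where "mode_span m = module.span fun_scale {g_mode m p r | p r. p \<in> multi_indices m}"

end

theory Submission
  imports Defs
begin

text \<open>
  The modes are the homogenisations of degree 2 of Hamiltonians depending on \<open>z = \<lambda>\<^sub>0/\<lambda>\<^sub>1\<close>: a loop
  \<open>x = \<Sum> x\<^sub>k \<otimes> \<lambda>\<^sup>k\<close> is sent to \<open>\<lambda>\<^sub>0\<^sup>2 \<Sum> z\<^sup>k x\<^sub>k(\<mu>/\<lambda>\<^sub>0)\<close>, which takes \<open>w[p] \<otimes> \<lambda>\<^sup>r\<close> to \<open>g[p;r]\<close>. Each of the
  two derivatives in the bracket contributes a factor \<open>1/\<lambda>\<^sub>0\<close>, so the bracket of two images is again
  of degree 2 and is the image of the loop bracket; the map is injective because Laurent monomials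
  in \<open>z\<close> are linearly independent. The Lie algebra axioms therefore need to be checked for polynomial
  Hamiltonians only, and they pass to loops and then to the modes.
\<close>

section \<open>Loop algebras and images of Lie algebras\<close>

text \<open>Off the diagonal the summands cancel in pairs. The diagonal is a separate hypothesis
  because antisymmetry gives only \<open>f k k + f k k = 0\<close>, and the group may have
  2-torsion. Induction peels off one row together with the matching column.\<close>

lemma sum_sum_alternating:
  fixes f :: "'i \<Rightarrow> 'i \<Rightarrow> 'a::ab_group_add"
  assumes "finite A" and "\<And>k. k \<in> A \<Longrightarrow> f k k = 0"
    and "\<And>k l. k \<in> A \<Longrightarrow> l \<in> A \<Longrightarrow> f k l = - f l k"
  shows "(\<Sum>k\<in>A. \<Sum>l\<in>A. f k l) = 0"
  using assms
proof (induction A)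
  case empty
  show ?case by simp
next
  case (insert a A)
  have "(\<Sum>k\<in>A. f k a) = - (\<Sum>l\<in>A. f a l)"
    unfolding sum_negf[symmetric] by (intro sum.cong refl insert.prems(2)) simp_all
  moreover have "(\<Sum>k\<in>A. \<Sum>l\<in>A. f k l) = 0"
    by (rule insert.IH; rule insert.prems; simp)
  moreover have "f a a = 0" using insert.prems(1) by simp
  ultimately show ?case using insert.hyps by (simp add: sum.distrib)
qed

section \<open>Bilinear calculus in a Lie algebra and its loop algebra\<close>

context lie_algebra
begin

lemma br_add_left: "x \<in> L \<Longrightarrow> y \<in> L \<Longrightarrow> z \<in> L \<Longrightarrow> br (x + y) z = br x z + br y z"
  using linear_left by (simp add: linear_map_on_def)

lemma br_add_right: "x \<in> L \<Longrightarrow> y \<in> L \<Longrightarrow> z \<in> L \<Longrightarrow> br z (x + y) = br z x + br z y"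
  using linear_right by (simp add: linear_map_on_def)

lemma br_scale_left: "x \<in> L \<Longrightarrow> z \<in> L \<Longrightarrow> br (scale c x) z = scale c (br x z)"
  using linear_left by (simp add: linear_map_on_def)

lemma br_scale_right: "x \<in> L \<Longrightarrow> z \<in> L \<Longrightarrow> br z (scale c x) = scale c (br z x)"
  using linear_right by (simp add: linear_map_on_def)

lemma zero_mem: "0 \<in> L"
  using subspace_carrier by (rule subspace_0)

lemma br_zero_left: "z \<in> L \<Longrightarrow> br 0 z = 0"
  using br_add_left[of 0 0 z] zero_mem by simp

lemma br_zero_right: "z \<in> L \<Longrightarrow> br z 0 = 0"
  using br_add_right[of 0 0 z] zero_mem by simp

lemma br_antisym:
  assumes "x \<in> L" and "y \<in> L"
  shows "br x y = - br y x"
proof -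
  have xy: "x + y \<in> L" using subspace_carrier assms by (rule subspace_add)
  have "0 = br (x + y) (x + y)" using xy by (simp add: alternating)
  also have "\<dots> = br x x + br x y + (br y x + br y y)"
    using assms xy by (simp add: br_add_left br_add_right)
  also have "\<dots> = br x y + br y x"
    using assms by (simp add: alternating)
  finally show ?thesis by (simp add: eq_neg_iff_add_eq_0)
qed

text \<open>Added index pairs contribute nothing, since the bracket with 0 vanishes. Loops with
  different supports can thus be expanded over common index sets and compared term by term.\<close>

lemma loop_bracket_superset:
  assumes "x \<in> loop_space L" "y \<in> loop_space L" "finite A" "finite B"
    and "Poly_Mapping.keys x \<subseteq> A" "Poly_Mapping.keys y \<subseteq> B"
  shows "loop_bracket br x y = (\<Sum>k\<in>A. \<Sum>l\<in>B.
    Poly_Mapping.single (k + l) (br (Poly_Mapping.lookup x k) (Poly_Mapping.lookup y l)))"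
proof -
  have mem: "Poly_Mapping.lookup x k \<in> L" "Poly_Mapping.lookup y k \<in> L" for k
    using assms(1,2) by (auto simp: loop_space_def)
  have "loop_bracket br x y = (\<Sum>k\<in>Poly_Mapping.keys x. \<Sum>l\<in>B.
    Poly_Mapping.single (k + l) (br (Poly_Mapping.lookup x k) (Poly_Mapping.lookup y l)))"
    unfolding loop_bracket_def
    by (intro sum.cong refl sum.mono_neutral_left)
      (use assms mem in \<open>auto simp: in_keys_iff br_zero_right\<close>)
  also have "\<dots> = (\<Sum>k\<in>A. \<Sum>l\<in>B.
    Poly_Mapping.single (k + l) (br (Poly_Mapping.lookup x k) (Poly_Mapping.lookup y l)))"
    by (intro sum.mono_neutral_left)
      (use assms mem in \<open>auto simp: in_keys_iff br_zero_left\<close>)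
  finally show ?thesis .
qed

lemma subspace_loop_space: "module.subspace (loop_scale scale) (loop_space L)"
proof -
  interpret lp: vector_space "loop_scale scale"
    by (rule vector_space_loop_scale) (rule vector_space_axioms)
  show ?thesis
    unfolding lp.subspace_def
    using subspace_carrier zero_mem
    by (auto simp: loop_space_def lookup_add lookup_loop_scale[OF vector_space_axioms]
        subspace_add subspace_scale)
qed

lemma single_mem_loop_space: "a \<in> L \<Longrightarrow> Poly_Mapping.single k a \<in> loop_space L"
  using zero_mem by (simp add: loop_space_def lookup_single when_def)

lemma lookup_mem: "x \<in> loop_space L \<Longrightarrow> Poly_Mapping.lookup x k \<in> L"
  by (simp add: loop_space_def)

lemma sum_mem_loop_space:
  "(\<And>i. i \<in> I \<Longrightarrow> f i \<in> loop_space L) \<Longrightarrow> sum f I \<in> loop_space L"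
proof -
  interpret lp: vector_space "loop_scale scale"
    by (rule vector_space_loop_scale) (rule vector_space_axioms)
  show "(\<And>i. i \<in> I \<Longrightarrow> f i \<in> loop_space L) \<Longrightarrow> sum f I \<in> loop_space L"
    by (rule lp.subspace_sum[OF subspace_loop_space])
qed

lemma loop_bracket_mem:
  "x \<in> loop_space L \<Longrightarrow> y \<in> loop_space L \<Longrightarrow> loop_bracket br x y \<in> loop_space L"
  unfolding loop_bracket_def
  by (intro sum_mem_loop_space single_mem_loop_space closed lookup_mem)

lemma loop_bracket_single:
  assumes "a \<in> L" and "b \<in> L"
  shows "loop_bracket br (Poly_Mapping.single k a) (Poly_Mapping.single l b) =
    Poly_Mapping.single (k + l) (br a b)"
  using assms by (auto simp: loop_bracket_def br_zero_left br_zero_right)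

lemma loop_bracket_add_left:
  assumes "x \<in> loop_space L" "y \<in> loop_space L" "z \<in> loop_space L"
  shows "loop_bracket br (x + y) z = loop_bracket br x z + loop_bracket br y z"
proof -
  let ?A = "Poly_Mapping.keys x \<union> Poly_Mapping.keys y"
  have xy: "x + y \<in> loop_space L"
    \<comment> \<open>Closure under addition comes from closure under sums, the two summands being
      indexed by the booleans.\<close>
    using sum_mem_loop_space[of "{True, False}" "\<lambda>b. if b then x else y"] assms by auto
  show ?thesis
    using assms keys_add[of x y] xy lookup_mem
    by (simp add: loop_bracket_superset[of _ _ ?A "Poly_Mapping.keys z"] lookup_add br_add_left
        single_add sum.distrib)
qed

lemma loop_bracket_add_right:
  assumes "x \<in> loop_space L" "y \<in> loop_space L" "z \<in> loop_space L"
  shows "loop_bracket br z (x + y) = loop_bracket br z x + loop_bracket br z y"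
proof -
  let ?A = "Poly_Mapping.keys x \<union> Poly_Mapping.keys y"
  have xy: "x + y \<in> loop_space L"
    using sum_mem_loop_space[of "{True, False}" "\<lambda>b. if b then x else y"] assms by auto
  show ?thesis
    using assms keys_add[of x y] xy lookup_mem
    by (simp add: loop_bracket_superset[of _ _ "Poly_Mapping.keys z" ?A] lookup_add br_add_right
        single_add sum.distrib)
qed

lemma loop_bracket_sum_right:
  assumes "\<And>i. i \<in> I \<Longrightarrow> f i \<in> loop_space L" and z: "z \<in> loop_space L" and "finite I"
  shows "loop_bracket br z (sum f I) = (\<Sum>i\<in>I. loop_bracket br z (f i))"
  using assms(3,1)
proof (induction I)
  case empty
  show ?case by (simp add: loop_bracket_def)
next
  case (insert a I)
  then show ?case
    using z by (simp add: loop_bracket_add_right sum_mem_loop_space)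
qed

lemma loop_scale_single: "loop_scale scale c (Poly_Mapping.single k a) = Poly_Mapping.single k (scale c a)"
  by (rule poly_mapping_eqI) (simp add: lookup_loop_scale[OF vector_space_axioms] lookup_single when_def)

text \<open>Only the inner bracket is expanded into one-term loops, so the support of
  \<open>loop_bracket br y z\<close> never has to be determined. The exponent is symmetric in the
  three indices, which lets the cyclic terms be added summand by summand.\<close>

lemma loop_bracket_triple:
  assumes "x \<in> loop_space L" "y \<in> loop_space L" "z \<in> loop_space L"
  shows "loop_bracket br x (loop_bracket br y z) =
    (\<Sum>k\<in>Poly_Mapping.keys x. \<Sum>j\<in>Poly_Mapping.keys y. \<Sum>l\<in>Poly_Mapping.keys z.
      Poly_Mapping.single (k + j + l)
        (br (Poly_Mapping.lookup x k) (br (Poly_Mapping.lookup y j) (Poly_Mapping.lookup z l))))"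
proof -
  let ?X = "Poly_Mapping.keys x" and ?Y = "Poly_Mapping.keys y" and ?Z = "Poly_Mapping.keys z"
  let ?x = "Poly_Mapping.lookup x" and ?y = "Poly_Mapping.lookup y" and ?z = "Poly_Mapping.lookup z"
  \<comment> \<open>The index set \<open>{n}\<close>, instead of the support of the one-term loop,
    also covers \<open>a = 0\<close>.\<close>
  have 1: "loop_bracket br x (Poly_Mapping.single n a) =
      (\<Sum>k\<in>?X. Poly_Mapping.single (k + n) (br (?x k) a))" if "a \<in> L" for n a
    using loop_bracket_superset[of x "Poly_Mapping.single n a" ?X "{n}"] that assms(1)
    by (simp add: single_mem_loop_space)
  have "loop_bracket br x (loop_bracket br y z) =
      (\<Sum>j\<in>?Y. \<Sum>l\<in>?Z. loop_bracket br x (Poly_Mapping.single (j + l) (br (?y j) (?z l))))"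
    unfolding loop_bracket_def[of br y z] using assms
    by (simp add: loop_bracket_sum_right sum_mem_loop_space single_mem_loop_space closed lookup_mem)
  also have "\<dots> = (\<Sum>j\<in>?Y. \<Sum>l\<in>?Z. \<Sum>k\<in>?X. Poly_Mapping.single (k + j + l) (br (?x k) (br (?y j) (?z l))))"
    using assms by (simp add: 1 closed lookup_mem add.assoc)
  also have "\<dots> = (\<Sum>j\<in>?Y. \<Sum>k\<in>?X. \<Sum>l\<in>?Z. Poly_Mapping.single (k + j + l) (br (?x k) (br (?y j) (?z l))))"
    by (rule sum.cong[OF refl sum.swap])
  also have "\<dots> = (\<Sum>k\<in>?X. \<Sum>j\<in>?Y. \<Sum>l\<in>?Z. Poly_Mapping.single (k + j + l) (br (?x k) (br (?y j) (?z l))))"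
    by (rule sum.swap)
  finally show ?thesis .
qed

text \<open>Once all three triple sums run in the order \<open>x\<close>, \<open>y\<close>,
  \<open>z\<close>, each coefficient is the Jacobi expression of elements of
  \<open>L\<close>.\<close>

lemma loop_bracket_jacobi:
  assumes "x \<in> loop_space L" "y \<in> loop_space L" "z \<in> loop_space L"
  shows "loop_bracket br x (loop_bracket br y z) + loop_bracket br y (loop_bracket br z x)
    + loop_bracket br z (loop_bracket br x y) = 0"
proof -
  let ?X = "Poly_Mapping.keys x" and ?Y = "Poly_Mapping.keys y" and ?Z = "Poly_Mapping.keys z"
  let ?x = "Poly_Mapping.lookup x" and ?y = "Poly_Mapping.lookup y" and ?z = "Poly_Mapping.lookup z"
  have y: "loop_bracket br y (loop_bracket br z x) =
      (\<Sum>k\<in>?X. \<Sum>j\<in>?Y. \<Sum>l\<in>?Z. Poly_Mapping.single (k + j + l) (br (?y j) (br (?z l) (?x k))))"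
  proof -
    have "loop_bracket br y (loop_bracket br z x) =
      (\<Sum>j\<in>?Y. \<Sum>l\<in>?Z. \<Sum>k\<in>?X. Poly_Mapping.single (k + j + l) (br (?y j) (br (?z l) (?x k))))"
      using assms by (simp add: loop_bracket_triple ac_simps)
    also have "\<dots> = (\<Sum>j\<in>?Y. \<Sum>k\<in>?X. \<Sum>l\<in>?Z. Poly_Mapping.single (k + j + l) (br (?y j) (br (?z l) (?x k))))"
      by (rule sum.cong[OF refl sum.swap])
    also have "\<dots> = (\<Sum>k\<in>?X. \<Sum>j\<in>?Y. \<Sum>l\<in>?Z. Poly_Mapping.single (k + j + l) (br (?y j) (br (?z l) (?x k))))"
      by (rule sum.swap)
    finally show ?thesis .
  qed
  have z: "loop_bracket br z (loop_bracket br x y) =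
      (\<Sum>k\<in>?X. \<Sum>j\<in>?Y. \<Sum>l\<in>?Z. Poly_Mapping.single (k + j + l) (br (?z l) (br (?x k) (?y j))))"
  proof -
    have "loop_bracket br z (loop_bracket br x y) =
      (\<Sum>l\<in>?Z. \<Sum>k\<in>?X. \<Sum>j\<in>?Y. Poly_Mapping.single (k + j + l) (br (?z l) (br (?x k) (?y j))))"
      using assms by (simp add: loop_bracket_triple ac_simps)
    also have "\<dots> = (\<Sum>k\<in>?X. \<Sum>l\<in>?Z. \<Sum>j\<in>?Y. Poly_Mapping.single (k + j + l) (br (?z l) (br (?x k) (?y j))))"
      by (rule sum.swap)
    also have "\<dots> = (\<Sum>k\<in>?X. \<Sum>j\<in>?Y. \<Sum>l\<in>?Z. Poly_Mapping.single (k + j + l) (br (?z l) (br (?x k) (?y j))))"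
      by (rule sum.cong[OF refl sum.swap])
    finally show ?thesis .
  qed
  show ?thesis
    unfolding y z loop_bracket_triple[OF assms] using assms
    by (simp add: sum.distrib[symmetric] single_add[symmetric] jacobi lookup_mem)
qed

lemma lie_algebra_loop: "lie_algebra (loop_scale scale) (loop_space L) (loop_bracket br)"
proof -
  note vs = vector_space_axioms
  interpret lp: vector_space "loop_scale scale"
    by (rule vector_space_loop_scale) (rule vs)
  have scale_mem: "loop_scale scale c x \<in> loop_space L" if "x \<in> loop_space L" for c x
    using subspace_loop_space that by (rule lp.subspace_scale)
  \<comment> \<open>Scaling by 0 empties the support, so only an inclusion holds; it suffices for
    \<open>loop_bracket_superset\<close>.\<close>
  have keys: "Poly_Mapping.keys (loop_scale scale c x) \<subseteq> Poly_Mapping.keys x" for c x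
    by (auto simp: in_keys_iff lookup_loop_scale[OF vs])
  show ?thesis
  proof (intro lie_algebra.intro lie_algebra_axioms.intro)
    fix y assume y: "y \<in> loop_space L"
    have "loop_bracket br (loop_scale scale c x) y = loop_scale scale c (loop_bracket br x y)"
      if "x \<in> loop_space L" for c x
      using that y keys[of c x] scale_mem[of x c]
      by (simp add: loop_bracket_superset[of _ y "Poly_Mapping.keys x" "Poly_Mapping.keys y"]
          lookup_loop_scale[OF vs] br_scale_left lookup_mem lp.scale_sum_right loop_scale_single)
    with y show "linear_map_on (loop_scale scale) (loop_scale scale) (loop_space L)
        (\<lambda>x. loop_bracket br x y)"
      by (simp add: linear_map_on_def loop_bracket_add_left)
    have "loop_bracket br y (loop_scale scale c x) = loop_scale scale c (loop_bracket br y x)"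
      if "x \<in> loop_space L" for c x
      using that y keys[of c x] scale_mem[of x c]
      by (simp add: loop_bracket_superset[of y _ "Poly_Mapping.keys y" "Poly_Mapping.keys x"]
          lookup_loop_scale[OF vs] br_scale_right lookup_mem lp.scale_sum_right loop_scale_single)
    with y show "linear_map_on (loop_scale scale) (loop_scale scale) (loop_space L)
        (loop_bracket br y)"
      by (simp add: linear_map_on_def loop_bracket_add_right)
    \<comment> \<open>The pairs \<open>(k, l)\<close> and \<open>(l, k)\<close> have the same
      exponent and opposite coefficients.\<close>
    show "loop_bracket br y y = 0"
      unfolding loop_bracket_def
    proof (rule sum_sum_alternating)
      fix k l
      show "Poly_Mapping.single (k + l) (br (Poly_Mapping.lookup y k) (Poly_Mapping.lookup y l)) =
        - Poly_Mapping.single (l + k) (br (Poly_Mapping.lookup y l) (Poly_Mapping.lookup y k))"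
        using br_antisym[of "Poly_Mapping.lookup y k" "Poly_Mapping.lookup y l"] lookup_mem[OF y]
        by (simp add: single_uminus add.commute)
    qed (use y in \<open>auto simp: alternating lookup_mem\<close>)
  qed (fact lp.vector_space_axioms subspace_loop_space loop_bracket_mem loop_bracket_jacobi)+
qed

section \<open>Transport of Lie algebra structures along linear maps\<close>

lemma lie_algebra_image:
  assumes f: "Vector_Spaces.linear scale s f"
    and hom: "\<And>x y. x \<in> L \<Longrightarrow> y \<in> L \<Longrightarrow> br' (f x) (f y) = f (br x y)"
  shows "lie_algebra s (f ` L) br'"
proof -
  interpret f: Vector_Spaces.linear scale s f by fact
  show ?thesis
  proof (intro lie_algebra.intro lie_algebra_axioms.intro)
    show "vector_space s" by unfold_locales
    show "module.subspace s (f ` L)"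
      using subspace_carrier by (rule f.subspace_image)
  next
    \<comment> \<open>By \<open>hom\<close>, every bracket of images is an image, so each axiom for
      \<open>br'\<close> is the image under \<open>f\<close> of the same axiom in
      \<open>L\<close>.\<close>
    fix u v w assume "u \<in> f ` L" "v \<in> f ` L" "w \<in> f ` L"
    then show "br' u (br' v w) + br' v (br' w u) + br' w (br' u v) = 0"
      by (auto simp: hom closed f.add[symmetric] jacobi)
  next
    fix u v assume "u \<in> f ` L" "v \<in> f ` L"
    then show "br' u v \<in> f ` L" by (auto simp: hom closed)
  next
    fix u assume "u \<in> f ` L"
    then show "br' u u = 0" by (auto simp: hom alternating)
  next
    fix v assume "v \<in> f ` L"
    then show "linear_map_on s s (f ` L) (\<lambda>x. br' x v)" "linear_map_on s s (f ` L) (br' v)"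
      using subspace_add[OF subspace_carrier] subspace_scale[OF subspace_carrier]
      by (auto simp: linear_map_on_def hom f.add[symmetric] f.scale[symmetric]
          br_add_left br_add_right br_scale_left br_scale_right)
  qed
qed

text \<open>The isomorphism runs from the image back to \<open>L\<close>, the direction from modes
  to loops, so the witness is the inverse \<open>inv_into L f\<close>.\<close>

lemma lie_isomorphic_image:
  assumes f: "Vector_Spaces.linear scale s f" and inj: "inj_on f L"
    and hom: "\<And>x y. x \<in> L \<Longrightarrow> y \<in> L \<Longrightarrow> br' (f x) (f y) = f (br x y)"
  shows "lie_isomorphic s (f ` L) br' scale L br"
proof -
  interpret f: Vector_Spaces.linear scale s f by fact
  have inv: "inv_into L f (f x) = x" if "x \<in> L" for x
    using inj that by simp
  have "bij_betw (inv_into L f) (f ` L) L"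
    using inj by (simp add: bij_betw_inv_into inj_on_imp_bij_betw)
  moreover have "linear_map_on s scale (f ` L) (inv_into L f)"
    using subspace_add[OF subspace_carrier] subspace_scale[OF subspace_carrier]
    by (auto simp: linear_map_on_def inv f.add[symmetric] f.scale[symmetric])
  moreover have "\<forall>u\<in>f ` L. \<forall>v\<in>f ` L. inv_into L f (br' u v) = br (inv_into L f u) (inv_into L f v)"
    by (auto simp: hom inv closed)
  moreover have "lie_algebra s (f ` L) br'" using f hom by (rule lie_algebra_image)
  ultimately show ?thesis
    using lie_algebra_axioms unfolding lie_isomorphic_def lie_isomorphism_def by blast
qed

end

section \<open>Polynomial Hamiltonians\<close>

interpretation fun_vs: vector_space fun_scale
  by (rule vector_space_fun_scale)

lemma fun_scale_apply: "fun_scale c f x = c * f x"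
  by (simp add: fun_scale_def)

text \<open>Kept out of the simplifier so that Hamiltonians are computed with as elements of the
  commutative ring of functions, with evaluation at points only on request.\<close>

lemmas pointwise = plus_fun_apply zero_fun_apply times_fun_apply fun_scale_apply

declare pointwise [simp del]

lemma fun_scale_mult_left [simp]: "fun_scale c f * g = fun_scale c (f * g)"
  by (simp add: fun_eq_iff pointwise)

lemma fun_scale_mult_right [simp]: "f * fun_scale c g = fun_scale c (f * g)"
  by (simp add: fun_eq_iff pointwise)

lemma fun_sum_apply: "(\<Sum>i\<in>I. f i) x = (\<Sum>i\<in>I. f i x)"
  by (induction I rule: infinite_finite_induct) (auto simp: pointwise)

lemma subspace_ham: "module.subspace fun_scale (ham m)"
  unfolding ham_def by (rule fun_vs.subspace_span)

lemma w_mode_mem_ham: "p \<in> multi_indices m \<Longrightarrow> w_mode m p \<in> ham m"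
  unfolding ham_def by (rule fun_vs.span_base) blast

text \<open>Span induction on the conjunction of \<open>P\<close> with membership in
  \<open>ham m\<close>: the sum and scaling cases may then use the derivative rules, which hold for
  polynomials.\<close>

lemma ham_induct [consumes 1, case_names zero add scale mode]:
  assumes "f \<in> ham m"
    and "P 0" and "\<And>f g. f \<in> ham m \<Longrightarrow> g \<in> ham m \<Longrightarrow> P f \<Longrightarrow> P g \<Longrightarrow> P (f + g)"
    and "\<And>c f. f \<in> ham m \<Longrightarrow> P f \<Longrightarrow> P (fun_scale c f)"
    and "\<And>p. p \<in> multi_indices m \<Longrightarrow> P (w_mode m p)"
  shows "P f"
proof -
  note sub = subspace_ham[of m]
  have "f \<in> ham m \<and> P f"
    using assms(1) unfolding ham_def
  proof (rule fun_vs.span_induct, fold ham_def)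
    show "module.subspace fun_scale {f. f \<in> ham m \<and> P f}"
      using assms(2-4) fun_vs.subspace_0[OF sub] fun_vs.subspace_add[OF sub]
        fun_vs.subspace_scale[OF sub] by (intro fun_vs.subspaceI) simp_all
  next
    fix g assume "g \<in> {w_mode m p | p. p \<in> multi_indices m}"
    then show "g \<in> ham m \<and> P g" using assms(5) w_mode_mem_ham by auto
  qed
  then show ?thesis by simp
qed

section \<open>Products and partial derivatives of polynomial Hamiltonians\<close>

lemma multi_indices_add: "p \<in> multi_indices m \<Longrightarrow> q \<in> multi_indices m \<Longrightarrow> p + q \<in> multi_indices m"
  by (simp add: multi_indices_def pointwise)

lemma multi_indices_diff: "p \<in> multi_indices m \<Longrightarrow> p - q \<in> multi_indices m"
  by (simp add: multi_indices_def)

lemma w_mode_mult: "w_mode m p * w_mode m q = w_mode m (p + q)"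
  by (simp add: w_mode_def fun_eq_iff power_add prod.distrib pointwise)

lemma ham_mult:
  assumes "f \<in> ham m" and "g \<in> ham m"
  shows "f * g \<in> ham m"
proof -
  note closed = fun_vs.subspace_0[OF subspace_ham] fun_vs.subspace_add[OF subspace_ham]
    fun_vs.subspace_scale[OF subspace_ham]
  have mode: "w_mode m p * g \<in> ham m" if "p \<in> multi_indices m" for p
    using assms(2)
    by (induction rule: ham_induct)
      (simp_all add: that closed w_mode_mult w_mode_mem_ham multi_indices_add distrib_left)
  show ?thesis
    using assms(1)
    by (induction rule: ham_induct)
      (simp_all add: mode closed distrib_right)
qed

text \<open>For an index in range the mode is \<open>z ^ p i\<close> times a factor free of
  \<open>z\<close>. For any other index it is constant in \<open>z\<close>, matching
  \<open>p i = 0\<close>. If \<open>p i = 0\<close>, the truncated exponent is multiplied by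
  zero.\<close>

lemma w_mode_has_field_derivative:
  assumes "p \<in> multi_indices m"
  shows "((\<lambda>z. w_mode m p (\<mu>(i := z))) has_field_derivative
    of_nat (p i) * w_mode m (p - unit_index i) (\<mu>(i := z))) (at z)"
proof (cases "i \<in> {1..2*m}")
  case True
  define C where "C = (\<Prod>j\<in>{1..2*m} - {i}. \<mu> j ^ p j)"
  have 1: "w_mode m p (\<mu>(i := z)) = z ^ p i * C" for z
    unfolding w_mode_def C_def using True by (subst prod.remove[of _ i]) (auto intro!: prod.cong)
  have 2: "w_mode m (p - unit_index i) (\<mu>(i := z)) = z ^ (p i - 1) * C" for z
    unfolding w_mode_def C_def using True
    by (subst prod.remove[of _ i]) (auto intro!: prod.cong simp: unit_index_def)
  show ?thesis unfolding 1 2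
    by (auto intro!: derivative_eq_intros)
next
  case False
  then have "w_mode m p (\<mu>(i := z)) = w_mode m p \<mu>" for z
    unfolding w_mode_def by (intro prod.cong) auto
  moreover have "p i = 0" using False assms by (simp add: multi_indices_def)
  ultimately show ?thesis by simp
qed

lemma ham_field_differentiable:
  assumes "f \<in> ham m"
  shows "(\<lambda>z. f (\<mu>(i := z))) field_differentiable at z"
  using assms
proof (induction rule: ham_induct)
  case (mode p)
  then show ?case
    using w_mode_has_field_derivative field_differentiable_def by blast
qed (auto intro!: derivative_intros simp: zero_fun_def pointwise)

text \<open>Guarantees that the value chosen by \<open>deriv\<close> is a genuine derivative, so
  that the usual differentiation rules apply to \<open>partial_deriv\<close>.\<close>

lemma ham_has_partial_deriv:
  assumes "f \<in> ham m"
  shows "((\<lambda>z. f (\<mu>(i := z))) has_field_derivative partial_deriv i f (\<mu>(i := z))) (at z)"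
  using ham_field_differentiable[OF assms, of \<mu> i z]
  by (simp add: partial_deriv_def field_differentiable_derivI)

lemma partial_deriv_eqI:
  assumes "\<And>\<mu>. ((\<lambda>z. f (\<mu>(i := z))) has_field_derivative g \<mu>) (at (\<mu> i))"
  shows "partial_deriv i f = g"
  using assms by (simp add: partial_deriv_def fun_eq_iff DERIV_imp_deriv)

lemma partial_deriv_w_mode:
  assumes "p \<in> multi_indices m"
  shows "partial_deriv i (w_mode m p) = fun_scale (of_nat (p i)) (w_mode m (p - unit_index i))"
  by (rule partial_deriv_eqI) (use w_mode_has_field_derivative[OF assms, of _ i] in \<open>simp add: pointwise, metis fun_upd_triv\<close>)

lemma partial_deriv_zero: "partial_deriv i 0 = 0"
  by (rule partial_deriv_eqI) (simp add: zero_fun_def)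

lemma partial_deriv_add:
  assumes "f \<in> ham m" and "g \<in> ham m"
  shows "partial_deriv i (f + g) = partial_deriv i f + partial_deriv i g"
proof (rule partial_deriv_eqI)
  fix \<mu>
  show "((\<lambda>z. (f + g) (\<mu>(i := z))) has_field_derivative (partial_deriv i f + partial_deriv i g) \<mu>) (at (\<mu> i))"
    using DERIV_add[OF ham_has_partial_deriv[OF assms(1), of \<mu> i "\<mu> i"] ham_has_partial_deriv[OF assms(2), of \<mu> i "\<mu> i"]]
    by (simp add: pointwise)
qed

lemma partial_deriv_mult:
  assumes "f \<in> ham m" and "g \<in> ham m"
  shows "partial_deriv i (f * g) = partial_deriv i f * g + f * partial_deriv i g"
proof (rule partial_deriv_eqI)
  fix \<mu>
  show "((\<lambda>z. (f * g) (\<mu>(i := z))) has_field_derivative (partial_deriv i f * g + f * partial_deriv i g) \<mu>) (at (\<mu> i))"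
    using DERIV_mult[OF ham_has_partial_deriv[OF assms(1), of \<mu> i "\<mu> i"] ham_has_partial_deriv[OF assms(2), of \<mu> i "\<mu> i"]]
    by (simp add: pointwise mult.commute)
qed

lemma partial_deriv_scale:
  assumes "f \<in> ham m"
  shows "partial_deriv i (fun_scale c f) = fun_scale c (partial_deriv i f)"
proof (rule partial_deriv_eqI)
  fix \<mu>
  show "((\<lambda>z. fun_scale c f (\<mu>(i := z))) has_field_derivative fun_scale c (partial_deriv i f) \<mu>) (at (\<mu> i))"
    using DERIV_cmult[OF ham_has_partial_deriv[OF assms, of \<mu> i "\<mu> i"], of c]
    by (simp add: pointwise)
qed

lemma partial_deriv_mem_ham:
  assumes "f \<in> ham m"
  shows "partial_deriv i f \<in> ham m"
  using assms
  by (induction rule: ham_induct)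
    (auto simp: partial_deriv_zero partial_deriv_add partial_deriv_scale partial_deriv_w_mode
      w_mode_mem_ham multi_indices_diff fun_vs.subspace_0[OF subspace_ham]
      fun_vs.subspace_add[OF subspace_ham] fun_vs.subspace_scale[OF subspace_ham])

lemma partial_deriv_commute:
  assumes "f \<in> ham m"
  shows "partial_deriv i (partial_deriv j f) = partial_deriv j (partial_deriv i f)"
  using assms
proof (induction rule: ham_induct)
  case (mode p)
  \<comment> \<open>Even with truncation, two successive subtractions remove the sum of the two unit
    indices, whatever their order.\<close>
  have "p - unit_index i - unit_index j = p - unit_index j - unit_index i"
    by (simp add: fun_eq_iff add.commute)
  with mode show ?case
    by (cases "i = j") (simp_all add: partial_deriv_w_mode[of _ m] partial_deriv_scale[of _ m]
        w_mode_mem_ham multi_indices_diff unit_index_def mult.commute)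
qed (simp_all add: partial_deriv_zero partial_deriv_add[of _ m] partial_deriv_scale[of _ m] partial_deriv_mem_ham)

section \<open>The Poisson bracket on polynomials and its Lie algebra axioms\<close>

lemma poisson_bracket_eq: "poisson_bracket m f g = (\<Sum>i=1..m.
    partial_deriv i f * partial_deriv (i + m) g - partial_deriv (i + m) f * partial_deriv i g)"
  by (simp add: poisson_bracket_def fun_eq_iff fun_sum_apply pointwise)

lemma poisson_bracket_mem_ham: "f \<in> ham m \<Longrightarrow> g \<in> ham m \<Longrightarrow> poisson_bracket m f g \<in> ham m"
  unfolding poisson_bracket_eq
  by (intro fun_vs.subspace_sum fun_vs.subspace_diff subspace_ham ham_mult partial_deriv_mem_ham)

lemma partial_deriv_sum:
  assumes "\<And>j. j \<in> J \<Longrightarrow> f j \<in> ham m"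
  shows "partial_deriv i (sum f J) = (\<Sum>j\<in>J. partial_deriv i (f j))"
  using assms
proof (induction J rule: infinite_finite_induct)
  case (insert j J)
  moreover have "sum f J \<in> ham m"
    using insert.prems by (intro fun_vs.subspace_sum subspace_ham) auto
  ultimately show ?case by (simp add: partial_deriv_add[of _ m])
qed (simp_all add: partial_deriv_zero)

lemma partial_deriv_diff:
  assumes "f \<in> ham m" and "g \<in> ham m"
  shows "partial_deriv i (f - g) = partial_deriv i f - partial_deriv i g"
  using partial_deriv_add[of "f - g" m g i] assms fun_vs.subspace_diff[OF subspace_ham]
  by (simp add: algebra_simps)

text \<open>A coordinate derivative is a derivation of the bracket: the product rule applies to each
  summand, and second derivatives commute. This expands the nested brackets of the Jacobi
  identity.\<close>

lemma partial_deriv_poisson: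
  assumes "f \<in> ham m" and "g \<in> ham m"
  shows "partial_deriv k (poisson_bracket m f g) =
    poisson_bracket m (partial_deriv k f) g + poisson_bracket m f (partial_deriv k g)"
proof -
  note mem = assms partial_deriv_mem_ham ham_mult fun_vs.subspace_diff[OF subspace_ham]
  show ?thesis
    unfolding poisson_bracket_eq sum.distrib[symmetric]
    by (subst partial_deriv_sum[of _ _ m], simp add: mem, rule sum.cong[OF refl])
      (simp add: mem partial_deriv_diff[of _ m] partial_deriv_mult[of _ m]
        partial_deriv_commute[OF assms(1), of k] partial_deriv_commute[OF assms(2), of k] algebra_simps)
qed

text \<open>
  In the double sum of the cyclic expression over pairs of conjugate coordinates, the summands at
  \<open>(i, j)\<close> and \<open>(j, i)\<close> cancel, because the Hessians are symmetric.
\<close>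

lemma poisson_jacobi:
  assumes f: "f \<in> ham m" and g: "g \<in> ham m" and h: "h \<in> ham m"
  shows "poisson_bracket m f (poisson_bracket m g h) + poisson_bracket m g (poisson_bracket m h f)
    + poisson_bracket m h (poisson_bracket m f g) = 0"
proof -
  let ?D = partial_deriv
  \<comment> \<open>The summand of \<open>{f, {g, h}}\<close>, with \<open>i\<close> from the outer
    bracket and \<open>j\<close> from the inner one after the outer derivative has been moved
    inside.\<close>
  define T where "T f g h i j =
      ?D i f * (?D j (?D (i + m) g) * ?D (j + m) h - ?D (j + m) (?D (i + m) g) * ?D j h
        + ?D j g * ?D (j + m) (?D (i + m) h) - ?D (j + m) g * ?D j (?D (i + m) h))
      - ?D (i + m) f * (?D j (?D i g) * ?D (j + m) h - ?D (j + m) (?D i g) * ?D j h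
        + ?D j g * ?D (j + m) (?D i h) - ?D (j + m) g * ?D j (?D i h))" for f g h i j
  have double: "poisson_bracket m f (poisson_bracket m g h) = (\<Sum>i=1..m. \<Sum>j=1..m. T f g h i j)"
    if "g \<in> ham m" "h \<in> ham m" for f g h
    unfolding poisson_bracket_eq[of m f] partial_deriv_poisson[OF that]
    unfolding poisson_bracket_eq sum.distrib[symmetric] sum_distrib_left sum_subtractf[symmetric] T_def
    by (intro sum.cong refl) (simp add: algebra_simps)
  define C where "C i j = T f g h i j + T g h f i j + T h f g i j" for i j
  have "C i j + C j i = 0" for i j
    unfolding C_def T_def
    using partial_deriv_commute[OF f, of i j] partial_deriv_commute[OF f, of "i + m" j]
      partial_deriv_commute[OF f, of i "j + m"] partial_deriv_commute[OF f, of "i + m" "j + m"]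
      partial_deriv_commute[OF g, of i j] partial_deriv_commute[OF g, of "i + m" j]
      partial_deriv_commute[OF g, of i "j + m"] partial_deriv_commute[OF g, of "i + m" "j + m"]
      partial_deriv_commute[OF h, of i j] partial_deriv_commute[OF h, of "i + m" j]
      partial_deriv_commute[OF h, of i "j + m"] partial_deriv_commute[OF h, of "i + m" "j + m"]
    by (simp add: algebra_simps)
  then have "(\<Sum>i=1..m. \<Sum>j=1..m. C i j + C j i) = 0" by simp
  moreover have "(\<Sum>i=1..m. \<Sum>j=1..m. C j i) = (\<Sum>i=1..m. \<Sum>j=1..m. C i j)"
    by (rule sum.swap)
  ultimately have "(\<Sum>i=1..m. \<Sum>j=1..m. C i j) + (\<Sum>i=1..m. \<Sum>j=1..m. C i j) = 0"
    by (simp add: sum.distrib)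
  \<comment> \<open>Halving takes place in the complex values of the functions.\<close>
  then have "(\<Sum>i=1..m. \<Sum>j=1..m. C i j) = 0"
    by (simp add: fun_eq_iff pointwise)
  then show ?thesis
    by (simp add: double f g h C_def sum.distrib)
qed

lemma lie_algebra_ham: "lie_algebra fun_scale (ham m) (poisson_bracket m)"
proof (intro lie_algebra.intro lie_algebra_axioms.intro)
  fix f assume f: "f \<in> ham m"
  show "poisson_bracket m f f = 0"
    by (simp add: poisson_bracket_eq mult.commute)
  show "linear_map_on fun_scale fun_scale (ham m) (\<lambda>g. poisson_bracket m g f)"
    "linear_map_on fun_scale fun_scale (ham m) (poisson_bracket m f)"
    by (auto simp: linear_map_on_def poisson_bracket_eq partial_deriv_add[of _ m]
        partial_deriv_scale[of _ m] fun_vs.scale_sum_right fun_vs.scale_right_diff_distrib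
        sum.distrib[symmetric] algebra_simps)
qed (fact fun_vs.vector_space_axioms subspace_ham poisson_bracket_mem_ham poisson_jacobi)+

lemma poisson_bracket_w_mode:
  assumes "p \<in> multi_indices m" and "q \<in> multi_indices m"
  shows "poisson_bracket m (w_mode m p) (w_mode m q) =
    (\<Sum>i=1..m. fun_scale (of_nat (p i) * of_nat (q (i + m)) - of_nat (p (i + m)) * of_nat (q i))
      (w_mode m (p + q - unit_index i - unit_index (i + m))))"
proof -
  \<comment> \<open>Without truncation the exponents add up as expected; in the remaining cases of
    the next step the coefficient is zero on both sides.\<close>
  have 1: "(p - unit_index i) + (q - unit_index j) = p + q - unit_index i - unit_index j"
    if "p i \<noteq> 0" "q j \<noteq> 0" for p q :: "nat \<Rightarrow> nat" and i j
    using that by (auto simp: fun_eq_iff unit_index_def pointwise)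
  have 2: "partial_deriv i (w_mode m p) * partial_deriv j (w_mode m q) =
      fun_scale (of_nat (p i) * of_nat (q j)) (w_mode m (p + q - unit_index i - unit_index j))" for i j
    using assms by (cases "p i = 0 \<or> q j = 0") (auto simp: partial_deriv_w_mode w_mode_mult 1)
  have 3: "p + q - unit_index (i + m) - unit_index i = p + q - unit_index i - unit_index (i + m)" for i
    by (simp add: fun_eq_iff add.commute)
  show ?thesis
    by (simp add: poisson_bracket_eq 2 3 fun_vs.scale_left_diff_distrib)
qed

section \<open>Evaluation of loops on the twistor space\<close>

text \<open>The zero value off the region agrees with that of \<open>g_mode\<close>, so images of
  loops can equal modes on the whole type.\<close>

definition loop_eval :: "(int \<Rightarrow>\<^sub>0 ((nat \<Rightarrow> complex) \<Rightarrow> complex)) \<Rightarrow> twistor_fun"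
  where "loop_eval x = (\<lambda>(\<mu>, l0, l1).
    if l0 \<noteq> 0 \<and> l1 \<noteq> 0
    then \<Sum>k\<in>Poly_Mapping.keys x. l0\<^sup>2 * (l0 / l1) powi k * Poly_Mapping.lookup x k (\<lambda>i. \<mu> i / l0)
    else 0)"

lemma loop_eval_superset:
  assumes "finite A" "Poly_Mapping.keys x \<subseteq> A"
  shows "loop_eval x (\<mu>, l0, l1) = (if l0 \<noteq> 0 \<and> l1 \<noteq> 0
    then \<Sum>k\<in>A. l0\<^sup>2 * (l0 / l1) powi k * Poly_Mapping.lookup x k (\<lambda>i. \<mu> i / l0) else 0)"
  using assms unfolding loop_eval_def
  by (auto intro!: sum.mono_neutral_left simp: in_keys_iff pointwise)

lemma linear_loop_eval: "Vector_Spaces.linear (loop_scale fun_scale) fun_scale loop_eval"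
proof -
  interpret lp: vector_space "loop_scale fun_scale"
    by (rule vector_space_loop_scale) (rule vector_space_fun_scale)
  have "loop_eval (x + y) v = loop_eval x v + loop_eval y v" for x y v
  proof -
    let ?A = "Poly_Mapping.keys x \<union> Poly_Mapping.keys y"
    show ?thesis
      using keys_add[of x y]
      by (cases v) (simp add: loop_eval_superset[of ?A] lookup_add pointwise distrib_left sum.distrib)
  qed
  moreover have "loop_eval (loop_scale fun_scale c x) v = c * loop_eval x v" for c x v
  proof -
    have "Poly_Mapping.keys (loop_scale fun_scale c x) \<subseteq> Poly_Mapping.keys x"
      by (auto simp: in_keys_iff lookup_loop_scale[OF vector_space_fun_scale])
    then show ?thesis
      by (cases v) (simp add: loop_eval_superset[of "Poly_Mapping.keys x"] pointwise
          lookup_loop_scale[OF vector_space_fun_scale] sum_distrib_left mult_ac)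
  qed
  ultimately show ?thesis
    by unfold_locales (simp_all add: fun_eq_iff pointwise)
qed

interpretation loop_eval: Vector_Spaces.linear "loop_scale fun_scale" fun_scale loop_eval
  by (rule linear_loop_eval)

lemma loop_eval_single: "loop_eval (Poly_Mapping.single k f) (\<mu>, l0, l1) =
  (if l0 \<noteq> 0 \<and> l1 \<noteq> 0 then l0\<^sup>2 * (l0 / l1) powi k * f (\<lambda>i. \<mu> i / l0) else 0)"
  by (subst loop_eval_superset[of "{k}"]) simp_all

text \<open>Rescaling the \<open>\<mu>\<close> coordinates costs \<open>l0\<close> to the power -P,
  where P is the total degree; with \<open>l0\<^sup>2\<close> and the power \<open>r\<close> of
  \<open>l0 / l1\<close> this leaves \<open>l0\<close> to the power 2 + r - P and \<open>l1\<close>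
  to the power -r.\<close>

lemma loop_eval_w_mode: "loop_eval (Poly_Mapping.single r (w_mode m p)) = g_mode m p r"
proof -
  have "l0\<^sup>2 * (l0 / l1) powi r * (\<Prod>i=1..2*m. (\<mu> i / l0) ^ p i) =
      (\<Prod>i=1..2*m. \<mu> i ^ p i) / (l0 powi (int (\<Sum>i=1..2*m. p i) - 2 - r) * l1 powi r)"
    if "l0 \<noteq> 0" "l1 \<noteq> 0" for \<mu> :: "nat \<Rightarrow> complex" and l0 l1
  proof -
    have "(\<Prod>i=1..2*m. (\<mu> i / l0) ^ p i) = (\<Prod>i=1..2*m. \<mu> i ^ p i) / l0 ^ (\<Sum>i=1..2*m. p i)"
      by (simp add: power_divide prod_dividef power_sum)
    moreover have "l0 powi (int P - 2 - r) = l0 ^ P / l0\<^sup>2 / l0 powi r" for P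
      using that by (simp add: power_int_diff)
    ultimately show ?thesis
      using that by (simp only: power_int_divide_distrib) (simp add: mult_ac)
  qed
  then show ?thesis
    by (auto simp: fun_eq_iff loop_eval_single g_mode_def w_mode_def)
qed

text \<open>The chain rule for \<open>\<mu> i / l0\<close> lowers the prefactor from
  \<open>l0\<^sup>2\<close> to \<open>l0\<close>.\<close>

lemma partial_deriv_loop_eval:
  assumes x: "x \<in> loop_space (ham m)" and l: "l0 \<noteq> 0" "l1 \<noteq> 0"
  shows "partial_deriv i (\<lambda>\<nu>. loop_eval x (\<nu>, l0, l1)) \<mu> =
    (\<Sum>k\<in>Poly_Mapping.keys x. l0 * (l0 / l1) powi k *
      partial_deriv i (Poly_Mapping.lookup x k) (\<lambda>j. \<mu> j / l0))"
proof -
  have upd: "(\<lambda>j. (\<mu>(i := z)) j / l0) = (\<lambda>j. \<mu> j / l0)(i := z / l0)" for z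
    by auto
  have "((\<lambda>z. Poly_Mapping.lookup x k (\<lambda>j. (\<mu>(i := z)) j / l0)) has_field_derivative
      partial_deriv i (Poly_Mapping.lookup x k) (\<lambda>j. \<mu> j / l0) * (1 / l0)) (at (\<mu> i))" for k
    unfolding upd
  proof (rule DERIV_chain2[where f = "\<lambda>z. Poly_Mapping.lookup x k ((\<lambda>j. \<mu> j / l0)(i := z))"])
    have "Poly_Mapping.lookup x k \<in> ham m" using x by (simp add: loop_space_def)
    from ham_has_partial_deriv[OF this, of "\<lambda>j. \<mu> j / l0" i "\<mu> i / l0"]
    show "((\<lambda>z. Poly_Mapping.lookup x k ((\<lambda>j. \<mu> j / l0)(i := z))) has_field_derivative
        partial_deriv i (Poly_Mapping.lookup x k) (\<lambda>j. \<mu> j / l0)) (at (\<mu> i / l0))"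
      by (simp add: fun_upd_idem)
    show "((\<lambda>z. z / l0) has_field_derivative 1 / l0) (at (\<mu> i))"
      using l by (auto intro!: derivative_eq_intros)
  qed
  then have "((\<lambda>z. \<Sum>k\<in>Poly_Mapping.keys x. l0\<^sup>2 * (l0 / l1) powi k *
        Poly_Mapping.lookup x k (\<lambda>j. (\<mu>(i := z)) j / l0)) has_field_derivative
      (\<Sum>k\<in>Poly_Mapping.keys x. l0\<^sup>2 * (l0 / l1) powi k *
        (partial_deriv i (Poly_Mapping.lookup x k) (\<lambda>j. \<mu> j / l0) * (1 / l0)))) (at (\<mu> i))"
    by (intro DERIV_sum DERIV_cmult)
  then have "((\<lambda>z. loop_eval x (\<mu>(i := z), l0, l1)) has_field_derivative
      (\<Sum>k\<in>Poly_Mapping.keys x. l0\<^sup>2 * (l0 / l1) powi k *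
        (partial_deriv i (Poly_Mapping.lookup x k) (\<lambda>j. \<mu> j / l0) * (1 / l0)))) (at (\<mu> i))"
    using l by (simp add: loop_eval_def)
  then show ?thesis
    using l by (simp add: partial_deriv_def DERIV_imp_deriv power2_eq_square mult_ac)
qed

lemma twistor_bracket_loop_eval:
  assumes x: "x \<in> loop_space (ham m)" and y: "y \<in> loop_space (ham m)"
  shows "twistor_bracket m (loop_eval x) (loop_eval y) = loop_eval (loop_bracket (poisson_bracket m) x y)"
proof
  fix v :: "(nat \<Rightarrow> complex) \<times> complex \<times> complex"
  obtain \<mu> l0 l1 where v: "v = (\<mu>, l0, l1)" by (cases v)
  let ?X = "Poly_Mapping.keys x" and ?Y = "Poly_Mapping.keys y"
  let ?x = "Poly_Mapping.lookup x" and ?y = "Poly_Mapping.lookup y"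
  let ?\<mu> = "\<lambda>j. \<mu> j / l0"
  show "twistor_bracket m (loop_eval x) (loop_eval y) v = loop_eval (loop_bracket (poisson_bracket m) x y) v"
  proof (cases "l0 \<noteq> 0 \<and> l1 \<noteq> 0")
    \<comment> \<open>Off the region both functions are identically zero in the \<open>\<mu>\<close>
      variables, and so are their derivatives.\<close>
    case False
    then show ?thesis
      by (auto simp: v twistor_bracket_def loop_eval_def poisson_bracket_def partial_deriv_def)
  next
    case True
    then have l: "l0 \<noteq> 0" "l1 \<noteq> 0" by auto
    \<comment> \<open>Two prefactors \<open>l0\<close> restore \<open>l0\<^sup>2\<close>, and the
      loop exponents add.\<close>
    have prod: "partial_deriv i (\<lambda>\<nu>. loop_eval x (\<nu>, l0, l1)) \<mu> * partial_deriv j (\<lambda>\<nu>. loop_eval y (\<nu>, l0, l1)) \<mu>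
      = (\<Sum>k\<in>?X. \<Sum>l\<in>?Y. l0\<^sup>2 * (l0 / l1) powi (k + l) * (partial_deriv i (?x k) ?\<mu> * partial_deriv j (?y l) ?\<mu>))" for i j
      unfolding partial_deriv_loop_eval[OF x l] partial_deriv_loop_eval[OF y l] sum_product
      using l by (intro sum.cong refl) (simp add: power_int_add power2_eq_square mult_ac)
    have "twistor_bracket m (loop_eval x) (loop_eval y) v = (\<Sum>i=1..m. \<Sum>k\<in>?X. \<Sum>l\<in>?Y. l0\<^sup>2 * (l0 / l1) powi (k + l) *
        (partial_deriv i (?x k) ?\<mu> * partial_deriv (i + m) (?y l) ?\<mu> - partial_deriv (i + m) (?x k) ?\<mu> * partial_deriv i (?y l) ?\<mu>))"
      by (simp add: v twistor_bracket_def poisson_bracket_def prod sum_subtractf right_diff_distrib)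
    also have "\<dots> = (\<Sum>k\<in>?X. \<Sum>i=1..m. \<Sum>l\<in>?Y. l0\<^sup>2 * (l0 / l1) powi (k + l) *
        (partial_deriv i (?x k) ?\<mu> * partial_deriv (i + m) (?y l) ?\<mu> - partial_deriv (i + m) (?x k) ?\<mu> * partial_deriv i (?y l) ?\<mu>))"
      by (rule sum.swap)
    also have "\<dots> = (\<Sum>k\<in>?X. \<Sum>l\<in>?Y. \<Sum>i=1..m. l0\<^sup>2 * (l0 / l1) powi (k + l) *
        (partial_deriv i (?x k) ?\<mu> * partial_deriv (i + m) (?y l) ?\<mu> - partial_deriv (i + m) (?x k) ?\<mu> * partial_deriv i (?y l) ?\<mu>))"
      by (rule sum.cong[OF refl sum.swap])
    also have "\<dots> = loop_eval (loop_bracket (poisson_bracket m) x y) v"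
      using l by (simp add: v loop_bracket_def loop_eval.sum fun_sum_apply loop_eval_single
          poisson_bracket_def sum_distrib_left)
    finally show ?thesis .
  qed
qed

section \<open>Linear independence of Laurent monomials and injectivity of evaluation\<close>

lemma laurent_polynomial_eq_0:
  fixes c :: "int \<Rightarrow> complex"
  assumes A: "finite A" and zero: "\<And>z. z \<noteq> 0 \<Longrightarrow> (\<Sum>k\<in>A. c k * z powi k) = 0" and k: "k \<in> A"
  shows "c k = 0"
proof -
  \<comment> \<open>Multiplication by \<open>z ^ N\<close> clears all negative powers and leaves an
    ordinary polynomial \<open>P\<close>.\<close>
  obtain N where N: "- int N \<le> j" if "j \<in> A" for j
  proof
    show "- int (nat (Max ((\<lambda>j. - j) ` A))) \<le> j" if "j \<in> A" for j
    proof -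
      have "- j \<le> Max ((\<lambda>j. - j) ` A)" using A that by (intro Max_ge) auto
      then show ?thesis by linarith
    qed
  qed
  define P where "P = (\<Sum>j\<in>A. monom (c j) (nat (j + int N)))"
  have "poly P z = 0" if "z \<noteq> 0" for z
  proof -
    have "poly P z = (\<Sum>j\<in>A. z ^ N * (c j * z powi j))"
      unfolding P_def poly_sum
    proof (rule sum.cong[OF refl])
      fix j assume "j \<in> A"
      then have "z ^ nat (j + int N) = z powi (j + int N)"
        using N[of j] by (simp add: power_int_def)
      with that show "poly (monom (c j) (nat (j + int N))) z = z ^ N * (c j * z powi j)"
        by (simp add: poly_monom power_int_add)
    qed
    also have "\<dots> = 0" using zero[OF that] by (simp add: sum_distrib_left[symmetric])
    finally show ?thesis .
  qed
  \<comment> \<open>A nonzero polynomial has finitely many roots, whereas \<open>P\<close> vanishes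
    on the whole punctured plane.\<close>
  then have "- {0} \<subseteq> {z. poly P z = 0}" by auto
  moreover have "infinite (- {0 :: complex})"
    by (simp add: infinite_UNIV_char_0 Compl_eq_Diff_UNIV)
  ultimately have "P = 0" using poly_roots_finite finite_subset by blast
  then have "0 = coeff P (nat (k + int N))" by simp
  also have "\<dots> = (\<Sum>j\<in>A. if j = k then c j else 0)"
    unfolding P_def coeff_sum
  proof (rule sum.cong[OF refl])
    \<comment> \<open>The shifted exponents are nonnegative, so \<open>nat\<close> keeps them
      distinct and each coefficient of \<open>P\<close> comes from a single term.\<close>
    fix j assume "j \<in> A"
    then have "nat (j + int N) = nat (k + int N) \<longleftrightarrow> j = k"
      using N[of j] N[OF k] by linarith
    then show "coeff (monom (c j) (nat (j + int N))) (nat (k + int N)) = (if j = k then c j else 0)"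
      by simp
  qed
  also have "\<dots> = c k" using A k by simp
  finally show ?thesis by simp
qed

lemma inj_loop_eval: "inj loop_eval"
proof -
  have "x = 0" if "loop_eval x = 0" for x
  proof (rule poly_mapping_eqI)
    fix k
    have "Poly_Mapping.lookup x k \<mu> = 0" if "k \<in> Poly_Mapping.keys x" for \<mu>
    proof (rule laurent_polynomial_eq_0[where c = "\<lambda>k. Poly_Mapping.lookup x k \<mu>"])
      fix z :: complex assume z: "z \<noteq> 0"
      \<comment> \<open>At \<open>l0 = 1\<close> and \<open>l1 = 1 / z\<close> no rescaling takes
        place and \<open>l0 / l1 = z\<close>: for fixed \<open>\<mu>\<close> this is a Laurent
        polynomial in \<open>z\<close> with coefficients \<open>lookup x k \<mu>\<close>.\<close>
      have "loop_eval x (\<mu>, 1, 1 / z) = 0"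
        using \<open>loop_eval x = 0\<close> by (simp add: pointwise)
      with z show "(\<Sum>k\<in>Poly_Mapping.keys x. Poly_Mapping.lookup x k \<mu> * z powi k) = 0"
        by (simp add: loop_eval_def mult.commute)
    qed (use that in auto)
    then show "Poly_Mapping.lookup x k = Poly_Mapping.lookup 0 k"
      by (cases "k \<in> Poly_Mapping.keys x") (auto simp: in_keys_iff fun_eq_iff pointwise)
  qed
  then show ?thesis
    using loop_eval.inj_iff_eq_0 by blast
qed

section \<open>Identification of the span of modes with the image of the loop algebra\<close>

lemma loop_space_ham_eq_span: "loop_space (ham m) =
  module.span (loop_scale fun_scale) {Poly_Mapping.single r (w_mode m p) | p r. p \<in> multi_indices m}"
  (is "_ = module.span _ ?B")
proof -
  interpret lie_algebra fun_scale "ham m" "poisson_bracket m"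
    by (rule lie_algebra_ham)
  interpret lp: vector_space "loop_scale fun_scale"
    by (rule vector_space_loop_scale) (rule vector_space_fun_scale)
  \<comment> \<open>A one-term loop is linear in its coefficient, so induction on the Hamiltonian
    applies; a general loop is a finite sum of such terms.\<close>
  have single: "Poly_Mapping.single k f \<in> lp.span ?B" if "f \<in> ham m" for k f
    using that
  proof (induction rule: ham_induct)
    case (mode p)
    then show ?case by (intro lp.span_base) blast
  qed (auto simp: single_add lp.span_zero lp.span_add lp.span_scale loop_scale_single[symmetric])
  show ?thesis
  proof
    show "loop_space (ham m) \<subseteq> lp.span ?B"
    proof
      fix x assume x: "x \<in> loop_space (ham m)"
      have "(\<Sum>k\<in>Poly_Mapping.keys x. Poly_Mapping.single k (Poly_Mapping.lookup x k)) \<in> lp.span ?B"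
        by (intro lp.span_sum single lookup_mem x)
      then show "x \<in> lp.span ?B" by (simp add: loop_space_decompose)
    qed
    show "lp.span ?B \<subseteq> loop_space (ham m)"
      by (rule lp.span_minimal[OF _ subspace_loop_space])
        (auto intro: single_mem_loop_space w_mode_mem_ham)
  qed
qed

lemma mode_span_eq_image: "mode_span m = loop_eval ` loop_space (ham m)"
proof -
  have "{g_mode m p r | p r. p \<in> multi_indices m} =
      loop_eval ` {Poly_Mapping.single r (w_mode m p) | p r. p \<in> multi_indices m}"
    unfolding loop_eval_w_mode[symmetric] by blast
  then show ?thesis
    unfolding mode_span_def loop_space_ham_eq_span by (simp add: loop_eval.span_image)
qed

lemma twistor_bracket_g_mode:
  assumes "p \<in> multi_indices m" and "q \<in> multi_indices m"
  shows "twistor_bracket m (g_mode m p r) (g_mode m q s) =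
    (\<Sum>i=1..m. fun_scale (of_nat (p i) * of_nat (q (i + m)) - of_nat (p (i + m)) * of_nat (q i))
      (g_mode m (p + q - unit_index i - unit_index (i + m)) (r + s)))"
proof -
  interpret lie_algebra fun_scale "ham m" "poisson_bracket m"
    by (rule lie_algebra_ham)
  have single_sum: "Poly_Mapping.single k (sum f I) = (\<Sum>i\<in>I. Poly_Mapping.single k (f i))"
    for k :: int and I :: "nat set" and f :: "nat \<Rightarrow> (nat \<Rightarrow> complex) \<Rightarrow> complex"
    by (induction I rule: infinite_finite_induct) (simp_all add: single_add)
  show ?thesis
    \<comment> \<open>Reading the modes as images of one-term loops reduces the formula to
      \<open>poisson_bracket_w_mode\<close>.\<close>
    unfolding loop_eval_w_mode[symmetric]
    using assms by (simp add: twistor_bracket_loop_eval single_mem_loop_space w_mode_mem_ham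
        loop_bracket_single poisson_bracket_w_mode single_sum loop_eval.sum
        loop_scale_single[symmetric] loop_eval.scale)
qed

theorem mainTheorem1:
  fixes m :: nat
  assumes "m \<ge> 1"
  shows "(\<forall>p\<in>multi_indices m. \<forall>q\<in>multi_indices m. \<forall>r s.
            twistor_bracket m (g_mode m p r) (g_mode m q s) =
            (\<Sum>i=1..m. fun_scale (of_nat (p i) * of_nat (q (i + m)) - of_nat (p (i + m)) * of_nat (q i))
              (g_mode m (p + q - unit_index i - unit_index (i + m)) (r + s))))
       \<and> (\<forall>f\<in>mode_span m. \<forall>h\<in>mode_span m. twistor_bracket m f h \<in> mode_span m)
       \<and> lie_isomorphic
           fun_scale (mode_span m) (twistor_bracket m)
           (loop_scale fun_scale) (loop_space (ham m)) (loop_bracket (poisson_bracket m))"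
proof (intro conjI ballI allI)
  interpret ham: lie_algebra fun_scale "ham m" "poisson_bracket m"
    by (rule lie_algebra_ham)
  interpret loop: lie_algebra "loop_scale fun_scale" "loop_space (ham m)" "loop_bracket (poisson_bracket m)"
    by (rule ham.lie_algebra_loop)
  have iso: "lie_isomorphic fun_scale (mode_span m) (twistor_bracket m)
      (loop_scale fun_scale) (loop_space (ham m)) (loop_bracket (poisson_bracket m))"
    unfolding mode_span_eq_image
    by (rule loop.lie_isomorphic_image[OF linear_loop_eval])
      (use inj_loop_eval in \<open>auto intro: inj_on_subset twistor_bracket_loop_eval\<close>)
  then show "lie_isomorphic fun_scale (mode_span m) (twistor_bracket m)
      (loop_scale fun_scale) (loop_space (ham m)) (loop_bracket (poisson_bracket m))" .
  show "twistor_bracket m f h \<in> mode_span m" if "f \<in> mode_span m" "h \<in> mode_span m" for f h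
    \<comment> \<open>Closure is one of the Lie algebra axioms contained in
      \<open>lie_isomorphic\<close>.\<close>
    using iso that lie_algebra.closed unfolding lie_isomorphic_def by blast
qed (rule twistor_bracket_g_mode)

end
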